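(* Let $K\subset O(n)$ be a finite pseudo-reflection group and $G=\mathbb{R}^n\rtimes K$. For every eigenspace representation $(T_\lambda,E_\lambda)$ of $G$ satisfying the generic property, there exists an induced representation $(\Phi,V)=\mathrm{Ind}_{\mathbb{R}^n}^{G}(\chi)$ satisfying the generic property such that there is a monomorphism (an injective $G$-equivariant linear map) from $\mathrm{Ind}_{\mathbb{R}^n}^{G}(\chi)$ to $(T_\lambda,E_\lambda)$.
   Context: A finite pseudo-reflection group is a finite subgroup $K$ of $O(n)$ generated by pseudo-reflections, where an element of a finite subgroup of $GL(\mathbb{R}^n)$ is a pseudo-reflection if precisely one of its eigenvalues (counted with multiplicity) is not equal to $1$. The group $G=\mathbb{R}^n\rtimes K$ has multiplication $(x_1,k_1)(x_2,k_2)=(x_1+k_1\cdot x_2,\,k_1k_2)$, and $G/K$ is identified with $\mathbb{R}^n$, on which $G$ acts by $(x,k)\cdot y=x+k\cdot y$. For $\lambda=(\lambda_1,\dots,\lambda_n)^T\in\mathbb{C}^n$, the joint eigenspace is $$E_\lambda=\{f\in C^\infty(\mathbb{R}^n,\mathbb{C})\mid P(\tfrac{\partial}{\partial x_1},\dots,\tfrac{\partial}{\partial x_n})f=P(\lambda_1,\dots,\lambda_n)f\ \ \forall P\in\mathbb{C}[x_1,\dots,x_n]^K\},$$ and $T_\lambda$ is the representation of $G$ on $E_\lambda$ given by $(T_\lambda(g)f)(x)=f(g^{-1}\cdot x)$. Every unitary character $\chi$ of $\mathbb{R}^n$ has the form $\chi(x)=e^{-\lambda^T x}$ with $\lambda\in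 i\mathbb{R}^n\subset\mathbb{C}^n$. Such a $\lambda$ or $\chi$ is called generic if $g\cdot\lambda\ne\lambda$ for all $g\in K$ with $g\ne e$. The representation $(T_\lambda,E_\lambda)$ satisfies the generic property if $\lambda\in i\mathbb{R}^n$ is generic, and $\mathrm{Ind}_{\mathbb{R}^n}^{G}(\chi)$ satisfies the generic property if $\chi$ is generic. The induced representation $(\Phi,V)=\mathrm{Ind}_{\mathbb{R}^n}^{G}(\chi)$ is the representation of $G$ on the space $V$ of functions $f:G\to\mathbb{C}$ with $f(g\,(x,e))=\chi(x)^{-1}f(g)$ for all $g\in G$, $x\in\mathbb{R}^n$ (such functions are automatically square integrable modulo $\mathbb{R}^n$, since $G/\mathbb{R}^n\cong K$ is finite), with $G$ acting by $(\Phi(g_0)f)(g)=f(g_0^{-1}g)$. *)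

theory Defs
  imports
    "HOL-Analysis.Analysis"
    "HOL-Algebra.Generated_Groups"
    "HOL-Computational_Algebra.Polynomial"
    "HOL-Library.Poly_Mapping"
begin

definition complex_matrix :: "real^'n^'n \<Rightarrow> complex^'n^'n" where
  "complex_matrix A = (\<chi> i j. complex_of_real (A $ i $ j))"

definition char_polynomial :: "real^'n^'n \<Rightarrow> complex poly" where
  "char_polynomial A = det (\<chi> i j. (if i = j then [:0, 1:] else 0) - [:complex_matrix A $ i $ j:])"

text \<open>The complex eigenvalues, each with its algebraic multiplicity.\<close>
definition eigenvalues :: "real^'n^'n \<Rightarrow> complex multiset" where
  "eigenvalues A = proots (char_polynomial A)"

definition pseudo_reflection :: "real^'n^'n \<Rightarrow> bool" where
  "pseudo_reflection A \<longleftrightarrow> size {#z \<in># eigenvalues A. z \<noteq> 1#} = 1"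

definition orthogonal_group :: "(real^'n^'n) monoid" where
  "orthogonal_group = \<lparr>carrier = {A. orthogonal_matrix A}, mult = (**), one = mat 1\<rparr>"

definition finite_pseudo_reflection_group :: "(real^'n^'n) set \<Rightarrow> bool" where
  "finite_pseudo_reflection_group K \<longleftrightarrow>
     finite K \<and> subgroup K orthogonal_group \<and>
     K = generate orthogonal_group {A \<in> K. pseudo_reflection A}"

definition semidirect :: "(real^'n^'n) set \<Rightarrow> ((real^'n) \<times> (real^'n^'n)) monoid" where
  "semidirect K = \<lparr>carrier = UNIV \<times> K,
     mult = (\<lambda>(x1, k1) (x2, k2). (x1 + k1 *v x2, k1 ** k2)),
     one = (0, mat 1)\<rparr>"

text \<open>The action of the semidirect product on its homogeneous space \<open>G/K\<close>, which is the
  underlying Euclidean space.\<close>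
definition affine_act :: "(real^'n) \<times> (real^'n^'n) \<Rightarrow> real^'n \<Rightarrow> real^'n" where
  "affine_act g y = fst g + snd g *v y"


text \<open>Polynomials in the variables \<open>x\<^sub>i\<close>, \<open>i :: 'n\<close>, are finitely supported maps from exponent
  vectors to coefficients.\<close>
type_synonym 'n cmpoly = "('n \<Rightarrow>\<^sub>0 nat) \<Rightarrow>\<^sub>0 complex"

definition eval_cmpoly :: "'n::finite cmpoly \<Rightarrow> complex^'n \<Rightarrow> complex" where
  "eval_cmpoly P z =
     (\<Sum>m\<in>Poly_Mapping.keys P. Poly_Mapping.lookup P m * (\<Prod>i\<in>UNIV. (z $ i) ^ Poly_Mapping.lookup m i))"

text \<open>Over the infinite field of complex numbers, a polynomial is determined by its values, so
  \<open>k \<cdot> P = P\<close> may be read pointwise.\<close>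
definition invariant_polynomials :: "(real^'n^'n) set \<Rightarrow> 'n cmpoly set" where
  "invariant_polynomials K =
     {P. \<forall>k\<in>K. \<forall>z. eval_cmpoly P (complex_matrix k *v z) = eval_cmpoly P z}"

definition partial :: "'n \<Rightarrow> (real^'n \<Rightarrow> complex) \<Rightarrow> real^'n \<Rightarrow> complex" where
  "partial i f x = vector_derivative (\<lambda>t. f (x + t *\<^sub>R axis i 1)) (at 0)"

text \<open>Smooth means that all iterated partial derivatives exist and are continuous;
  \<open>foldr partial js f\<close> is the iterated partial derivative along the list \<open>js\<close> of coordinates.\<close>
definition smooth :: "(real^'n \<Rightarrow> complex) \<Rightarrow> bool" where
  "smooth f \<longleftrightarrow> (\<forall>js. continuous_on UNIV (foldr partial js f) \<and>
     (\<forall>i x. (\<lambda>t::real. foldr partial js f (x + t *\<^sub>R axis i 1)) differentiable (at 0)))"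

text \<open>The index type carries no order, so the coordinates are processed along an arbitrary
  enumeration; on smooth functions partial derivatives commute and the choice does not matter.\<close>
definition mixed_partial :: "('n::finite \<Rightarrow>\<^sub>0 nat) \<Rightarrow> (real^'n \<Rightarrow> complex) \<Rightarrow> real^'n \<Rightarrow> complex" where
  "mixed_partial m f =
     foldr (\<lambda>i. partial i ^^ Poly_Mapping.lookup m i) (SOME js. distinct js \<and> set js = UNIV) f"

definition diff_operator :: "'n::finite cmpoly \<Rightarrow> (real^'n \<Rightarrow> complex) \<Rightarrow> real^'n \<Rightarrow> complex" where
  "diff_operator P f x =
     (\<Sum>m\<in>Poly_Mapping.keys P. Poly_Mapping.lookup P m * mixed_partial m f x)"

definition joint_eigenspace ::
    "(real^'n^'n) set \<Rightarrow> complex^'n \<Rightarrow> (real^'n \<Rightarrow> complex) set" where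
  "joint_eigenspace K l =
     {f. smooth f \<and> (\<forall>P\<in>invariant_polynomials K. \<forall>x. diff_operator P f x = eval_cmpoly P l * f x)}"

definition eigenspace_action :: "(real^'n^'n) set \<Rightarrow> (real^'n) \<times> (real^'n^'n) \<Rightarrow>
    (real^'n \<Rightarrow> complex) \<Rightarrow> real^'n \<Rightarrow> complex" where
  "eigenspace_action K g f = (\<lambda>x. f (affine_act (inv\<^bsub>semidirect K\<^esub> g) x))"


definition imaginary_vector :: "complex^'n \<Rightarrow> bool" where
  "imaginary_vector l \<longleftrightarrow> (\<forall>i. Re (l $ i) = 0)"

definition generic_vector :: "(real^'n^'n) set \<Rightarrow> complex^'n \<Rightarrow> bool" where
  "generic_vector K l \<longleftrightarrow> (\<forall>k\<in>K. k \<noteq> mat 1 \<longrightarrow> complex_matrix k *v l \<noteq> l)"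

definition unitary_character :: "(real^'n \<Rightarrow> complex) \<Rightarrow> bool" where
  "unitary_character c \<longleftrightarrow>
     continuous_on UNIV c \<and> (\<forall>x. norm (c x) = 1) \<and> (\<forall>x y. c (x + y) = c x * c y)"

definition generic_character :: "(real^'n^'n) set \<Rightarrow> (real^'n \<Rightarrow> complex) \<Rightarrow> bool" where
  "generic_character K c \<longleftrightarrow>
     (\<exists>l. imaginary_vector l \<and> (\<forall>x. c x = exp (- (\<Sum>i\<in>UNIV. l $ i * complex_of_real (x $ i)))) \<and>
          generic_vector K l)"

text \<open>Functions on \<open>G\<close> are total functions vanishing off the carrier, so that distinct elements of
  the space below are distinct as functions on \<open>G\<close>.\<close>
definition induced_space :: "(real^'n^'n) set \<Rightarrow> (real^'n \<Rightarrow> complex) \<Rightarrow>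
    ((real^'n) \<times> (real^'n^'n) \<Rightarrow> complex) set" where
  "induced_space K c =
     {f. (\<forall>g. g \<notin> carrier (semidirect K) \<longrightarrow> f g = 0) \<and>
         (\<forall>g\<in>carrier (semidirect K). \<forall>x.
            f (g \<otimes>\<^bsub>semidirect K\<^esub> (x, mat 1)) = inverse (c x) * f g)}"

definition induced_action :: "(real^'n^'n) set \<Rightarrow> (real^'n) \<times> (real^'n^'n) \<Rightarrow>
    ((real^'n) \<times> (real^'n^'n) \<Rightarrow> complex) \<Rightarrow> (real^'n) \<times> (real^'n^'n) \<Rightarrow> complex" where
  "induced_action K g0 f =
     (\<lambda>g. if g \<in> carrier (semidirect K)
          then f (inv\<^bsub>semidirect K\<^esub> g0 \<otimes>\<^bsub>semidirect K\<^esub> g) else 0)"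


definition complex_subspace :: "('x \<Rightarrow> complex) set \<Rightarrow> bool" where
  "complex_subspace V \<longleftrightarrow> (\<lambda>x. 0) \<in> V \<and>
     (\<forall>f\<in>V. \<forall>h\<in>V. (\<lambda>x. f x + h x) \<in> V) \<and> (\<forall>a. \<forall>f\<in>V. (\<lambda>x. a * f x) \<in> V)"

definition complex_linear_on ::
    "('x \<Rightarrow> complex) set \<Rightarrow> (('x \<Rightarrow> complex) \<Rightarrow> 'y \<Rightarrow> complex) \<Rightarrow> bool" where
  "complex_linear_on V A \<longleftrightarrow>
     (\<forall>f\<in>V. \<forall>h\<in>V. A (\<lambda>x. f x + h x) = (\<lambda>y. A f y + A h y)) \<and>
     (\<forall>a. \<forall>f\<in>V. A (\<lambda>x. a * f x) = (\<lambda>y. a * A f y))"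

definition representation :: "('g, 'm) monoid_scheme \<Rightarrow>
    ('g \<Rightarrow> ('x \<Rightarrow> complex) \<Rightarrow> 'x \<Rightarrow> complex) \<Rightarrow> ('x \<Rightarrow> complex) set \<Rightarrow> bool" where
  "representation G T V \<longleftrightarrow> group G \<and> complex_subspace V \<and>
     (\<forall>g\<in>carrier G. complex_linear_on V (T g) \<and> (\<forall>f\<in>V. T g f \<in> V)) \<and>
     (\<forall>f\<in>V. T \<one>\<^bsub>G\<^esub> f = f) \<and>
     (\<forall>g\<in>carrier G. \<forall>h\<in>carrier G. \<forall>f\<in>V. T (g \<otimes>\<^bsub>G\<^esub> h) f = T g (T h f))"

definition rep_monomorphism :: "('g, 'm) monoid_scheme \<Rightarrow>
    ('g \<Rightarrow> ('x \<Rightarrow> complex) \<Rightarrow> 'x \<Rightarrow> complex) \<Rightarrow> ('x \<Rightarrow> complex) set \<Rightarrow>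
    ('g \<Rightarrow> ('y \<Rightarrow> complex) \<Rightarrow> 'y \<Rightarrow> complex) \<Rightarrow> ('y \<Rightarrow> complex) set \<Rightarrow>
    (('x \<Rightarrow> complex) \<Rightarrow> 'y \<Rightarrow> complex) \<Rightarrow> bool" where
  "rep_monomorphism G S V T W A \<longleftrightarrow>
     representation G S V \<and> representation G T W \<and>
     complex_linear_on V A \<and> A ` V \<subseteq> W \<and> inj_on A V \<and>
     (\<forall>g\<in>carrier G. \<forall>f\<in>V. A (S g f) = T g (A f))"

end

theory Submission
  imports Defs
begin

text \<open>
  Take \<open>\<chi> x = exp (- l \<bullet> x)\<close>, where \<open>l \<bullet> x\<close> is the bilinear pairing of \<open>l\<close> and \<open>x\<close>. An element \<open>f\<close> of the induced space is
  determined by its values on \<open>K\<close>: since \<open>(x, k) = (0, k) (k\<^sup>T x, 1)\<close>, covariance under translations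
  gives \<open>f (x, k) = f (0, k) exp (k l \<bullet> x)\<close>. The monomorphism sums \<open>f\<close> over the fibres of
  \<open>G \<rightarrow> G/K\<close>,
  \<open>(A f) x = (\<Sum>k\<in>K. f (x, k)) = (\<Sum>k\<in>K. f (0, k) exp (k l \<bullet> x))\<close>.
  Left translation on \<open>G\<close> permutes the fibres, so \<open>A\<close> is equivariant
  (\<open>fibre_sum_equivariant\<close>). A polynomial \<open>P\<close> in the partial derivatives multiplies
  \<open>exp (k l \<bullet> x)\<close> by \<open>P (k l)\<close>, which is \<open>P l\<close> when \<open>P\<close> is invariant, so \<open>A f\<close> lies in the joint
  eigenspace (\<open>fibre_sum_in_joint_eigenspace\<close>). Genericity makes the vectors \<open>k l\<close> pairwise distinct;
  distinct exponentials are linearly independent, hence \<open>A f\<close> determines the coefficients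
  \<open>f (0, k)\<close> and therefore \<open>f\<close> (\<open>fibre_sum_inj\<close>).

  Most of the work lies in showing that the joint eigenspace is a representation of \<open>G\<close> at all,
  that is, that invariant operators commute with the motions \<open>x \<mapsto> y + k x\<close>
  (\<open>diff_operator_affine\<close>). By the chain rule, differentiating \<open>f (y + k x)\<close> amounts to applying to
  \<open>f\<close> the operator whose symbol is composed with \<open>k\<^sup>T\<close>. For invariant \<open>P\<close> the new symbol has the same
  values as \<open>P\<close>, hence is the same polynomial (\<open>cmpoly_eqI\<close>), hence gives the same operator. The
  chain rule requires that coordinate derivatives control all directional ones
  (\<open>smooth_directional_derivative\<close>), and regrouping iterated derivatives requires that they commute
  (\<open>partial_commute\<close>).

  Dedekind's theorem on the independence of multiplicative functions (\<open>dedekind_independence\<close>) is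
  used twice: for the monomials, which gives \<open>cmpoly_eqI\<close>, and for the exponentials.
\<close>

section \<open>Calculus of smooth functions\<close>

lemma smooth_partial:
  assumes "smooth f"
  shows "smooth (partial i f)"
proof -
  have "foldr partial js (partial i f) = foldr partial (js @ [i]) f" for js
    by simp
  then show ?thesis
    using assms unfolding smooth_def by metis
qed

lemma smooth_continuous:
  assumes "smooth f"
  shows "continuous_on UNIV f"
  using assms unfolding smooth_def by (metis foldr.simps(1) id_apply)

text \<open>Smoothness is the largest property that implies continuity and differentiability along the axes
  and is inherited by partial derivatives. A function is therefore shown to be smooth by exhibiting
  a class of functions containing it that is closed under partial derivatives; this avoids computing
  its iterated derivatives.\<close>

lemma smooth_coinduct:
  assumes "f \<in> S"
    and "\<And>g. g \<in> S \<Longrightarrow> continuous_on UNIV g"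
    and "\<And>g i x. g \<in> S \<Longrightarrow> (\<lambda>t::real. g (x + t *\<^sub>R axis i 1)) differentiable (at 0)"
    and "\<And>g i. g \<in> S \<Longrightarrow> partial i g \<in> S"
  shows "smooth f"
proof -
  have "foldr partial js f \<in> S" for js
    by (induction js) (use assms(1,4) in auto)
  then show ?thesis
    unfolding smooth_def using assms(2,3) by blast
qed

lemma partial_eqI:
  assumes "((\<lambda>t. f (x + t *\<^sub>R axis i 1)) has_vector_derivative d) (at 0)"
  shows "partial i f x = d"
  unfolding partial_def using assms by (rule vector_derivative_at)

lemma smooth_has_partial_derivative:
  assumes "smooth f"
  shows "((\<lambda>t. f (x + t *\<^sub>R axis i 1)) has_vector_derivative partial i f (x + s *\<^sub>R axis i 1)) (at s within S)"
proof -
  let ?y = "x + s *\<^sub>R axis i 1"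
  have "(\<lambda>t::real. foldr partial [] f (?y + t *\<^sub>R axis i 1)) differentiable (at 0)"
    using assms unfolding smooth_def by blast
  then have "((\<lambda>t. f (?y + t *\<^sub>R axis i 1)) has_vector_derivative partial i f ?y) (at (s - s))"
    by (simp add: partial_def vector_derivative_works)
  then have "(((\<lambda>t. f (?y + t *\<^sub>R axis i 1)) \<circ> (\<lambda>t. t - s)) has_vector_derivative 1 *\<^sub>R partial i f ?y) (at s)"
    by (intro vector_diff_chain_at) (auto intro!: derivative_eq_intros)
  then show ?thesis
    by (auto simp: o_def algebra_simps intro: has_vector_derivative_at_within)
qed

text \<open>The coordinates are added to the direction one at a time. Moving by \<open>t\<close> along the old
  direction and by \<open>s\<close> along the new axis gives a function of two real variables with a partial
  derivative in \<open>t\<close> and a continuous one in \<open>s\<close>; it is therefore differentiable, and the claim is its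
  derivative along the diagonal \<open>s = t\<close>. The base point and \<open>t\<close> stay arbitrary because the derivative in \<open>t\<close> is needed
  at points displaced along the new axis.\<close>

lemma smooth_directional_derivative_on:
  fixes f :: "real^'n \<Rightarrow> complex"
  assumes f: "smooth f" and "finite A"
  shows "((\<lambda>t. f (x + t *\<^sub>R (\<Sum>i\<in>A. v $ i *\<^sub>R axis i 1))) has_vector_derivative
     (\<Sum>i\<in>A. v $ i *\<^sub>R partial i f (x + t *\<^sub>R (\<Sum>i\<in>A. v $ i *\<^sub>R axis i 1)))) (at t)"
  using \<open>finite A\<close>
proof (induction A arbitrary: x t rule: finite_induct)
  case empty
  then show ?case by simp
next
  case (insert a A)
  define w :: "real^'n" where "w = (\<Sum>i\<in>A. v $ i *\<^sub>R axis i 1)"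
  define e :: "real^'n" where "e = axis a 1"
  define F where "F t s = f (x + t *\<^sub>R w + (s * v $ a) *\<^sub>R e)" for t s :: real
  define Fs where "Fs t s = v $ a *\<^sub>R partial a f (x + t *\<^sub>R w + (s * v $ a) *\<^sub>R e)" for t s :: real
  define d where "d = (\<Sum>i\<in>A. v $ i *\<^sub>R partial i f (x + t *\<^sub>R w + (t * v $ a) *\<^sub>R e))"
  have cont: "continuous_on UNIV (partial a f)"
    by (intro smooth_continuous smooth_partial f)
  have Ft: "((\<lambda>t'. F t' t) has_vector_derivative d) (at t)"
  proof -
    have swap: "x + (t * v $ a) *\<^sub>R e + r *\<^sub>R w = x + r *\<^sub>R w + (t * v $ a) *\<^sub>R e" for r
      by simp
    show ?thesis
      using insert.IH[of "x + (t * v $ a) *\<^sub>R e" t] unfolding w_def[symmetric] swap F_def d_def .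
  qed
  have Fs: "((\<lambda>s. F r s) has_derivative blinfun_scaleR_left (Fs r s)) (at s)" for r s
  proof -
    have "(((\<lambda>s. f (x + r *\<^sub>R w + s *\<^sub>R e)) \<circ> (\<lambda>s. s * v $ a)) has_vector_derivative
        v $ a *\<^sub>R partial a f (x + r *\<^sub>R w + (s * v $ a) *\<^sub>R e)) (at s)"
      unfolding e_def
      by (intro vector_diff_chain_at smooth_has_partial_derivative f)
        (auto intro!: derivative_eq_intros)
    then show ?thesis
      by (simp add: F_def Fs_def o_def has_vector_derivative_def)
  qed
  have FsC: "continuous (at (t, t) within UNIV \<times> UNIV) (\<lambda>(t, s). blinfun_scaleR_left (Fs t s))"
  proof -
    have "continuous_on UNIV (\<lambda>p::real \<times> real. blinfun_scaleR_left (Fs (fst p) (snd p)))"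
      unfolding Fs_def
      by (intro continuous_intros continuous_on_compose2[OF cont]) auto
    then show ?thesis
      by (auto simp: case_prod_beta' continuous_on_eq_continuous_within simp del: split_paired_All)
  qed
  have "((\<lambda>(t, s). F t s) has_derivative (\<lambda>(tx, ty). tx *\<^sub>R d + blinfun_scaleR_left (Fs t t) ty))
      (at (t, t) within UNIV \<times> UNIV)"
    by (rule has_derivative_partialsI) (use Ft Fs FsC in \<open>auto simp: has_vector_derivative_def\<close>)
  then have "((\<lambda>(t, s). F t s) has_derivative (\<lambda>(tx, ty). tx *\<^sub>R d + ty *\<^sub>R Fs t t)) (at (t, t))"
    by simp
  then have "((\<lambda>(t, s). F t s) \<circ> (\<lambda>t. (t, t)) has_derivative
      (\<lambda>(tx, ty). tx *\<^sub>R d + ty *\<^sub>R Fs t t) \<circ> (\<lambda>t. (t, t))) (at t)"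
    by (intro diff_chain_at) (auto intro!: derivative_eq_intros)
  then have deriv: "((\<lambda>t. F t t) has_vector_derivative (Fs t t + d)) (at t)"
    by (simp add: o_def has_vector_derivative_def scaleR_add_right add.commute)
  have eq: "x + t *\<^sub>R (\<Sum>i\<in>insert a A. v $ i *\<^sub>R axis i 1) = x + t *\<^sub>R w + (t * v $ a) *\<^sub>R e" for t
    using insert.hyps by (simp add: w_def e_def algebra_simps)
  show ?case
    unfolding eq using insert.hyps deriv by (simp add: F_def Fs_def d_def)
qed

lemma smooth_directional_derivative:
  fixes f :: "real^'n \<Rightarrow> complex"
  assumes "smooth f"
  shows "((\<lambda>t. f (x + t *\<^sub>R v)) has_vector_derivative (\<Sum>i\<in>UNIV. v $ i *\<^sub>R partial i f x)) (at 0)"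
proof -
  have "(\<Sum>i\<in>UNIV. v $ i *\<^sub>R axis i 1) = v"
    by (simp add: vec_eq_iff axis_def if_distrib sum.delta cong: if_cong)
  then show ?thesis
    using smooth_directional_derivative_on[OF assms finite, of x v UNIV 0] by simp
qed

lemma smooth_sum_properties:
  assumes "finite J" and "\<And>j. j \<in> J \<Longrightarrow> smooth (f j)"
  shows smooth_linear_combination: "smooth (\<lambda>x. \<Sum>j\<in>J. c j * f j x)"
    and partial_linear_combination:
      "partial i (\<lambda>x. \<Sum>j\<in>J. c j * f j x) = (\<lambda>x. \<Sum>j\<in>J. c j * partial i (f j) x)"
proof -
  have deriv: "((\<lambda>t. \<Sum>j\<in>J. c j * g j (x + t *\<^sub>R axis i 1)) has_vector_derivative
      (\<Sum>j\<in>J. c j * partial i (g j) x)) (at 0)"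
    if "\<And>j. j \<in> J \<Longrightarrow> smooth (g j)" for g and i and x :: "real^'b"
    using smooth_has_partial_derivative[OF that, where s = 0 and x = x and i = i]
    by (intro has_vector_derivative_sum has_vector_derivative_mult_right) simp
  have part: "partial i (\<lambda>x. \<Sum>j\<in>J. c j * g j x) = (\<lambda>x. \<Sum>j\<in>J. c j * partial i (g j) x)"
    if "\<And>j. j \<in> J \<Longrightarrow> smooth (g j)" for g :: "'a \<Rightarrow> real^'b \<Rightarrow> complex" and i
    using deriv[OF that] by (intro ext partial_eqI)
  then show "partial i (\<lambda>x. \<Sum>j\<in>J. c j * f j x) = (\<lambda>x. \<Sum>j\<in>J. c j * partial i (f j) x)"
    using assms(2) by blast
  show "smooth (\<lambda>x. \<Sum>j\<in>J. c j * f j x)"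
  proof (rule smooth_coinduct[where S = "{\<lambda>x. \<Sum>j\<in>J. c j * g j x | g. \<forall>j\<in>J. smooth (g j)}"])
    show "(\<lambda>x. \<Sum>j\<in>J. c j * f j x) \<in> {\<lambda>x. \<Sum>j\<in>J. c j * g j x | g. \<forall>j\<in>J. smooth (g j)}"
      using assms(2) by blast
  next
    fix h :: "real^'b \<Rightarrow> complex" assume "h \<in> {\<lambda>x. \<Sum>j\<in>J. c j * g j x | g. \<forall>j\<in>J. smooth (g j)}"
    then obtain g where g: "\<And>j. j \<in> J \<Longrightarrow> smooth (g j)" and h: "h = (\<lambda>x. \<Sum>j\<in>J. c j * g j x)"
      by blast
    show "continuous_on UNIV h"
      unfolding h by (intro continuous_intros smooth_continuous g)
    show "(\<lambda>t::real. h (x + t *\<^sub>R axis i 1)) differentiable (at 0)" for i x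
      unfolding h using deriv[OF g] by (rule differentiableI_vector)
    show "partial i h \<in> {\<lambda>x. \<Sum>j\<in>J. c j * g j x | g. \<forall>j\<in>J. smooth (g j)}" for i
      unfolding h
      by (intro CollectI exI[of _ "\<lambda>j. partial i (g j)"] conjI ballI part smooth_partial g)
  qed
qed

text \<open>The curve \<open>t \<mapsto> y + k (x + t e\<^sub>i)\<close> is a line whose direction is the \<open>i\<close>-th column of \<open>k\<close>, so the
  partial derivative is a directional derivative of \<open>f\<close>. It is again a smooth function composed with
  the same affine map, so these compositions form a class closed under partial derivatives.\<close>

lemma smooth_affine_properties:
  fixes f :: "real^'n \<Rightarrow> complex" and k :: "real^'n^'n"
  assumes "smooth f"
  shows partial_affine: "partial i (\<lambda>x. f (y + k *v x)) = (\<lambda>x. \<Sum>j\<in>UNIV. complex_of_real (k $ j $ i) * partial j f (y + k *v x))"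
    and smooth_compose_affine: "smooth (\<lambda>x. f (y + k *v x))"
proof -
  have deriv: "((\<lambda>t. g (y + k *v (x + t *\<^sub>R axis i 1))) has_vector_derivative
      (\<Sum>j\<in>UNIV. complex_of_real (k $ j $ i) * partial j g (y + k *v x))) (at 0)"
    if "smooth g" for g x i
  proof -
    have *: "y + k *v (x + t *\<^sub>R axis i 1) = (y + k *v x) + t *\<^sub>R column i k" for t
      by (simp add: matrix_vector_right_distrib matrix_vector_mult_scaleR matrix_vector_mult_basis add.assoc)
    show ?thesis
      unfolding * using smooth_directional_derivative[OF that, of "y + k *v x" "column i k"]
      by (simp add: column_def scaleR_conv_of_real)
  qed
  have part: "partial i (\<lambda>x. g (y + k *v x)) = (\<lambda>x. \<Sum>j\<in>UNIV. complex_of_real (k $ j $ i) * partial j g (y + k *v x))"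
    if "smooth g" for g i
    using deriv[OF that] by (intro ext partial_eqI)
  then show "partial i (\<lambda>x. f (y + k *v x)) = (\<lambda>x. \<Sum>j\<in>UNIV. complex_of_real (k $ j $ i) * partial j f (y + k *v x))"
    using assms by blast
  show "smooth (\<lambda>x. f (y + k *v x))"
  proof (rule smooth_coinduct[where S = "{\<lambda>x. g (y + k *v x) | g. smooth g}"])
    show "(\<lambda>x. f (y + k *v x)) \<in> {\<lambda>x. g (y + k *v x) | g. smooth g}"
      using assms by blast
  next
    fix h assume "h \<in> {\<lambda>x. g (y + k *v x) | g. smooth g}"
    then obtain g where g: "smooth g" and h: "h = (\<lambda>x. g (y + k *v x))"
      by blast
    show "continuous_on UNIV h"
      unfolding h by (intro continuous_on_compose2[OF smooth_continuous[OF g]] continuous_intros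
          matrix_vector_mult_linear_continuous_on) auto
    show "(\<lambda>t::real. h (x + t *\<^sub>R axis i 1)) differentiable (at 0)" for i x
      unfolding h using deriv[OF g] by (rule differentiableI_vector)
    have "smooth (\<lambda>x. \<Sum>j\<in>UNIV. complex_of_real (k $ j $ i) * partial j g x)" for i
      by (intro smooth_linear_combination smooth_partial g finite)
    then show "partial i h \<in> {\<lambda>x. g (y + k *v x) | g. smooth g}" for i
      unfolding h part[OF g]
      by (intro CollectI exI[of _ "\<lambda>x. \<Sum>j\<in>UNIV. complex_of_real (k $ j $ i) * partial j g x"] conjI refl)
  qed
qed

text \<open>Schwarz's theorem. Integrating \<open>\<partial>\<^sub>j f\<close> from \<open>0\<close> to \<open>t\<close> along the \<open>j\<close>-th axis gives an increment of
  \<open>f\<close>; differentiating under the integral along the \<open>i\<close>-th axis turns this into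
  \<open>\<integral> \<partial>\<^sub>i \<partial>\<^sub>j f = \<partial>\<^sub>i f (x + t e\<^sub>j) - \<partial>\<^sub>i f x\<close>. The derivatives of both sides at \<open>t = 0\<close> are the two mixed
  derivatives.\<close>

lemma partial_commute:
  assumes f: "smooth f"
  shows "partial i (partial j f) = partial j (partial i f)"
proof
  fix x :: "real^'a"
  define p where "p s t = x + s *\<^sub>R axis i 1 + t *\<^sub>R axis j 1" for s t :: real
  have contp: "continuous_on S (\<lambda>q. p (u q) (w q))"
    if "continuous_on S u" "continuous_on S w" for S :: "'c::topological_space set" and u w
    unfolding p_def by (intro continuous_intros that)
  define \<Delta> where "\<Delta> t = partial i f (p 0 t) - partial i f x" for t
  note conts = smooth_continuous[OF smooth_partial[OF f]]
    smooth_continuous[OF smooth_partial[OF smooth_partial[OF f]]]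
  have ftc: "((\<lambda>r. partial j f (p s r)) has_integral f (p s t) - f (p s 0)) {0..t}" if "0 \<le> t" for s t
    unfolding p_def
    by (rule fundamental_theorem_of_calculus[OF that]) (rule smooth_has_partial_derivative[OF f])
  have *: "integral {0..t} (\<lambda>r. partial i (partial j f) (p 0 r)) = \<Delta> t" if t: "0 \<le> t" for t
  proof -
    have d1: "((\<lambda>s. partial j f (p s r)) has_vector_derivative partial i (partial j f) (p s r)) (at s within UNIV)" for s r
      using smooth_has_partial_derivative[OF smooth_partial[OF f, of j], where x = "x + r *\<^sub>R axis j 1" and i = i and s = s and S = UNIV]
      by (simp add: p_def add.commute add.left_commute)
    have "((\<lambda>s. integral (cbox 0 t) (\<lambda>r. partial j f (p s r))) has_vector_derivative
        integral (cbox 0 t) (\<lambda>r. partial i (partial j f) (p 0 r))) (at 0 within UNIV)"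
    proof (rule leibniz_rule_vector_derivative)
      show "continuous_on (UNIV \<times> cbox 0 t) (\<lambda>(s, r). partial i (partial j f) (p s r))"
        unfolding split_beta
        by (intro continuous_on_compose2[OF conts(2)] contp continuous_intros) auto
    qed (use d1 ftc[OF t] in \<open>auto intro: has_integral_integrable\<close>)
    moreover have "(\<lambda>s. integral (cbox 0 t) (\<lambda>r. partial j f (p s r))) = (\<lambda>s. f (p s t) - f (p s 0))"
      using integral_unique[OF ftc[OF t]] by simp
    moreover have "((\<lambda>s. f (p s t) - f (p s 0)) has_vector_derivative \<Delta> t) (at 0)"
    proof -
      have "((\<lambda>s. f (p s r)) has_vector_derivative partial i f (p 0 r)) (at 0)" for r
        using smooth_has_partial_derivative[OF f, where x = "x + r *\<^sub>R axis j 1" and i = i and s = 0 and S = UNIV]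
        by (simp add: p_def add.commute add.left_commute)
      from has_vector_derivative_diff[OF this[of t] this[of 0]] show ?thesis
        by (simp add: \<Delta>_def p_def)
    qed
    ultimately show ?thesis
      by (intro vector_derivative_unique_at[where f = "\<lambda>s. f (p s t) - f (p s 0)" and x = 0]) simp_all
  qed
  \<comment> \<open>For \<open>t < 0\<close> the interval of integration is empty, so both derivatives in \<open>t\<close> are one-sided.\<close>
  have "((\<lambda>t. integral {0..t} (\<lambda>r. partial i (partial j f) (p 0 r))) has_vector_derivative
      partial i (partial j f) (p 0 0)) (at 0 within {0..1})"
    by (rule integral_has_vector_derivative)
      (auto intro!: continuous_on_compose2[OF conts(2)] contp continuous_intros)
  moreover have "p 0 0 = x"
    by (simp add: p_def)
  ultimately have "(\<Delta> has_vector_derivative partial i (partial j f) x) (at 0 within {0..1})"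
    by (auto intro: has_vector_derivative_transform[rotated 2] simp: *)
  moreover have "(\<Delta> has_vector_derivative partial j (partial i f) x) (at 0 within {0..1})"
    using smooth_has_partial_derivative[OF smooth_partial[OF f, of i], where x = x and i = j and s = 0 and S = "{0..1}"]
    unfolding \<Delta>_def by (auto simp: p_def intro!: derivative_eq_intros)
  ultimately show "partial i (partial j f) x = partial j (partial i f) x"
    by (intro vector_derivative_unique_within[of 0 "{0..1}"]) (auto simp: at_within_Icc_at_right trivial_limit_at_right_real)
qed

section \<open>Independence of multiplicative functions\<close>

text \<open>Dedekind's argument: a linear relation can be translated by any \<open>b\<close>, and since two of the
  functions differ at some \<open>b\<close>, a combination of the relation with its translate is a shorter relation.
  The operation is arbitrary because both the multiplicative monoid of complex
  vectors and the additive group of real vectors occur below.\<close>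

lemma dedekind_independence:
  fixes \<phi> :: "'s \<Rightarrow> 'a \<Rightarrow> 'k::field" and op :: "'a \<Rightarrow> 'a \<Rightarrow> 'a"
  assumes "finite S" and "inj_on \<phi> S"
    and mult: "\<And>s a b. s \<in> S \<Longrightarrow> \<phi> s (op a b) = \<phi> s a * \<phi> s b"
    and nonzero: "\<And>s. s \<in> S \<Longrightarrow> \<exists>a. \<phi> s a \<noteq> 0"
    and "\<And>a. (\<Sum>s\<in>S. c s * \<phi> s a) = 0"
    and "s \<in> S"
  shows "c s = 0"
  using assms
proof (induction S arbitrary: c s rule: finite_induct)
  case empty
  then show ?case by simp
next
  case (insert r S)
  have inS: "c s = 0" if s: "s \<in> S" for s
  proof -
    have "r \<noteq> s"
      using s insert.hyps by blast
    then have "\<phi> r \<noteq> \<phi> s"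
      using insert.prems(1) s by (auto simp: inj_on_def)
    then obtain b where b: "\<phi> r b \<noteq> \<phi> s b"
      by blast
    \<comment> \<open>Multiplying the relation by \<open>\<phi> r b\<close> and subtracting it from the relation at \<open>op b a\<close>
      removes the term of \<open>r\<close>.\<close>
    have "(\<Sum>s\<in>S. (c s * (\<phi> s b - \<phi> r b)) * \<phi> s a) = 0" for a
    proof -
      have "0 = (\<Sum>s\<in>insert r S. c s * \<phi> s (op b a)) - \<phi> r b * (\<Sum>s\<in>insert r S. c s * \<phi> s a)"
        using insert.prems(4) by simp
      also have "\<dots> = (\<Sum>s\<in>insert r S. (c s * (\<phi> s b - \<phi> r b)) * \<phi> s a)"
        unfolding sum_distrib_left sum_subtractf[symmetric]
        by (rule sum.cong) (auto simp: insert.prems(2) algebra_simps)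
      also have "\<dots> = (\<Sum>s\<in>S. (c s * (\<phi> s b - \<phi> r b)) * \<phi> s a)"
        using insert.hyps by simp
      finally show ?thesis by simp
    qed
    then have "c s * (\<phi> s b - \<phi> r b) = 0"
    proof (rule insert.IH[rotated 3])
      show "inj_on \<phi> S"
        using insert.prems(1) by simp
    qed (use insert.prems(2,3) s in simp_all)
    then show ?thesis
      using b by simp
  qed
  obtain a where "\<phi> r a \<noteq> 0"
    using insert.prems(3) by blast
  then have "c r = 0"
    using insert.prems(4)[of a] insert.hyps inS by simp
  then show ?case
    using inS insert.prems(5) by blast
qed

section \<open>Polynomials and constant-coefficient operators\<close>

lemma eval_cmpoly_0 [simp]: "eval_cmpoly 0 z = 0"
  and diff_operator_0 [simp]: "diff_operator 0 f x = 0"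
  by (simp_all add: eval_cmpoly_def diff_operator_def)

lemma eval_cmpoly_single [simp]:
    "eval_cmpoly (Poly_Mapping.single m c) z = c * (\<Prod>i\<in>UNIV. (z $ i) ^ Poly_Mapping.lookup m i)"
  and diff_operator_single [simp]:
    "diff_operator (Poly_Mapping.single m c) f x = c * mixed_partial m f x"
  by (simp_all add: eval_cmpoly_def diff_operator_def)

lemma eval_cmpoly_add: "eval_cmpoly (P + Q) z = eval_cmpoly P z + eval_cmpoly Q z"
  unfolding eval_cmpoly_def by (intro setsum_keys_plus_distrib) (auto simp: algebra_simps)

lemma diff_operator_add: "diff_operator (P + Q) f x = diff_operator P f x + diff_operator Q f x"
  unfolding diff_operator_def by (intro setsum_keys_plus_distrib) (auto simp: algebra_simps)

lemma eval_cmpoly_sum: "eval_cmpoly (\<Sum>s\<in>S. P s) z = (\<Sum>s\<in>S. eval_cmpoly (P s) z)"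
  by (induction S rule: infinite_finite_induct) (auto simp: eval_cmpoly_add)

lemma diff_operator_sum: "diff_operator (\<Sum>s\<in>S. P s) f x = (\<Sum>s\<in>S. diff_operator (P s) f x)"
  by (induction S rule: infinite_finite_induct) (auto simp: diff_operator_add)

lemma eval_cmpoly_scale: "eval_cmpoly (Poly_Mapping.map ((*) c) P) z = c * eval_cmpoly P z"
  and diff_operator_scale: "diff_operator (Poly_Mapping.map ((*) c) P) f x = c * diff_operator P f x"
proof -
  have *: "(\<Sum>m\<in>Poly_Mapping.keys (Poly_Mapping.map ((*) c) P). Poly_Mapping.lookup (Poly_Mapping.map ((*) c) P) m * F m)
      = c * (\<Sum>m\<in>Poly_Mapping.keys P. Poly_Mapping.lookup P m * F m)" for F :: "_ \<Rightarrow> complex"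
    unfolding sum_distrib_left
    by (intro sum.mono_neutral_cong_left)
      (auto simp: in_keys_iff Poly_Mapping.map.rep_eq when_def mult.assoc split: if_splits)
  show "eval_cmpoly (Poly_Mapping.map ((*) c) P) z = c * eval_cmpoly P z"
    "diff_operator (Poly_Mapping.map ((*) c) P) f x = c * diff_operator P f x"
    unfolding eval_cmpoly_def diff_operator_def by (rule *)+
qed

text \<open>Monomials are distinct multiplicative functions for the componentwise product of vectors, since
  evaluation at a vector with one entry \<open>2\<close> and all others \<open>1\<close> reads off an exponent. Their independence
  makes a polynomial recoverable from its values, and so lets an invariance of values be transferred
  to differential operators.\<close>

lemma cmpoly_eqI:
  fixes P Q :: "'n::finite cmpoly"
  assumes "\<And>z. eval_cmpoly P z = eval_cmpoly Q z"
  shows "P = Q"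
proof -
  define R where "R = P + Poly_Mapping.map ((*) (-1)) Q"
  define mono where "mono m = (\<lambda>z::complex^'n. \<Prod>i\<in>UNIV. (z $ i) ^ Poly_Mapping.lookup m i)"
    for m :: "'n \<Rightarrow>\<^sub>0 nat"
  have inj: "inj_on mono (Poly_Mapping.keys R)"
  proof (rule inj_onI, rule poly_mapping_eqI)
    fix m m' :: "'n \<Rightarrow>\<^sub>0 nat" and i
    assume eq: "mono m = mono m'"
    have "mono k (\<chi> j. if j = i then 2 else 1) = 2 ^ Poly_Mapping.lookup k i" for k
    proof -
      have "mono k (\<chi> j. if j = i then 2 else 1)
          = (\<Prod>j\<in>UNIV. if j = i then 2 ^ Poly_Mapping.lookup k i else 1)"
        unfolding mono_def by (rule prod.cong) auto
      then show ?thesis by simp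
    qed
    then have "(2::complex) ^ Poly_Mapping.lookup m i = 2 ^ Poly_Mapping.lookup m' i"
      using eq by metis
    then have "norm ((2::complex) ^ Poly_Mapping.lookup m i) = norm ((2::complex) ^ Poly_Mapping.lookup m' i)"
      by simp
    then show "Poly_Mapping.lookup m i = Poly_Mapping.lookup m' i"
      by (simp add: norm_power)
  qed
  have "Poly_Mapping.lookup R m = 0" if "m \<in> Poly_Mapping.keys R" for m
  proof (rule dedekind_independence[where \<phi> = mono and c = "Poly_Mapping.lookup R" and S = "Poly_Mapping.keys R"
        and op = "\<lambda>z w. \<chi> i. z $ i * w $ i", OF finite_keys inj _ _ _ that])
    show "mono m (\<chi> i. z $ i * w $ i) = mono m z * mono m w" for m z w
      by (simp add: mono_def power_mult_distrib prod.distrib)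
    show "\<exists>z. mono m z \<noteq> 0" for m
      by (rule exI[of _ "\<chi> i. 1"]) (simp add: mono_def)
    have "eval_cmpoly R z = 0" for z
      using assms by (simp add: R_def eval_cmpoly_add eval_cmpoly_scale)
    then show "(\<Sum>m\<in>Poly_Mapping.keys R. Poly_Mapping.lookup R m * mono m z) = 0" for z
      by (simp add: eval_cmpoly_def mono_def)
  qed
  then have "Poly_Mapping.lookup R m = 0" for m
    by (metis in_keys_iff)
  moreover have "Poly_Mapping.lookup R m = Poly_Mapping.lookup P m - Poly_Mapping.lookup Q m" for m
    by (simp add: R_def lookup_add Poly_Mapping.map.rep_eq when_def)
  ultimately show ?thesis
    by (intro poly_mapping_eqI) simp
qed

lemma funpow_partial_smooth:
  "smooth f \<Longrightarrow> smooth ((partial i ^^ k) f)"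
  by (induction k) (auto intro: smooth_partial)

lemma funpow_partial_commute:
  "smooth f \<Longrightarrow> (partial j ^^ k) (partial i f) = partial i ((partial j ^^ k) f)"
  by (induction k) (auto simp: partial_commute funpow_partial_smooth)

lemma foldr_funpow_partial_smooth:
  "smooth f \<Longrightarrow> smooth (foldr (\<lambda>j. partial j ^^ e j) js f)"
  by (induction js) (auto intro: funpow_partial_smooth)

text \<open>An extra derivative inserted at its place in the enumeration of the coordinates can be pulled out
  to the front, past the derivatives in the other coordinates.\<close>

lemma foldr_funpow_partial_Suc:
  assumes "smooth f" and "distinct js"
  shows "foldr (\<lambda>j. partial j ^^ (e(i := Suc (e i))) j) js f =
    (if i \<in> set js then partial i (foldr (\<lambda>j. partial j ^^ e j) js f)
     else foldr (\<lambda>j. partial j ^^ e j) js f)"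
  using assms(2)
proof (induction js)
  case Nil
  then show ?case by simp
next
  case (Cons j js)
  then show ?case
    using funpow_partial_commute[OF foldr_funpow_partial_smooth[OF assms(1)]] by auto
qed

lemma coordinate_enumeration:
  "distinct (SOME js. distinct js \<and> set js = (UNIV :: 'n::finite set))"
  "set (SOME js. distinct js \<and> set js = (UNIV :: 'n::finite set)) = UNIV"
  using someI_ex[OF finite_distinct_list[OF finite, of "UNIV :: 'n set"], simplified conj_commute]
  by auto

lemma mixed_partial_smooth: "smooth f \<Longrightarrow> smooth (mixed_partial m f)"
  unfolding mixed_partial_def by (rule foldr_funpow_partial_smooth)

lemma mixed_partial_0: "mixed_partial 0 f = f"
proof -
  have "foldr (\<lambda>i. partial i ^^ Poly_Mapping.lookup 0 i) js f = f" for js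
    by (induction js) auto
  then show ?thesis
    by (simp add: mixed_partial_def)
qed

lemma mixed_partial_Suc:
  assumes "smooth f"
  shows "mixed_partial (m + Poly_Mapping.single i 1) f = partial i (mixed_partial m f)"
proof -
  have "Poly_Mapping.lookup (m + Poly_Mapping.single i 1) =
      (Poly_Mapping.lookup m)(i := Suc (Poly_Mapping.lookup m i))"
    by (auto simp: lookup_add lookup_single when_def)
  then show ?thesis
    unfolding mixed_partial_def
    using foldr_funpow_partial_Suc[OF assms coordinate_enumeration(1), of "Poly_Mapping.lookup m" i]
    by (simp add: coordinate_enumeration(2))
qed

text \<open>Together with \<open>mixed_partial_0\<close> and \<open>mixed_partial_Suc\<close>, this induction replaces every further
  reference to the enumeration of the coordinates.\<close>

lemma exponent_induct [case_names zero Suc]: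
  fixes m :: "'n::finite \<Rightarrow>\<^sub>0 nat"
  assumes "Q 0" and "\<And>m i. Q m \<Longrightarrow> Q (m + Poly_Mapping.single i 1)"
  shows "Q m"
proof (induction "\<Sum>i\<in>UNIV. Poly_Mapping.lookup m i" arbitrary: m)
  case 0
  then have "m = 0"
    by (intro poly_mapping_eqI) simp
  then show ?case
    using assms(1) by simp
next
  case (Suc d)
  then obtain i where i: "Poly_Mapping.lookup m i > 0"
    by (metis gr0I nat.distinct(1) sum.neutral)
  define m' where "m' = m - Poly_Mapping.single i 1"
  have m: "m = m' + Poly_Mapping.single i 1"
    using i by (intro poly_mapping_eqI) (auto simp: m'_def lookup_add lookup_minus lookup_single when_def)
  have "(\<Sum>j\<in>UNIV. Poly_Mapping.lookup m j) = (\<Sum>j\<in>UNIV. Poly_Mapping.lookup m' j) + 1"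
    unfolding m by (simp add: lookup_add lookup_single sum.distrib when_def)
  then have "Q m'"
    using Suc by (intro Suc.hyps(1)) simp
  then show ?case
    unfolding m by (rule assms(2))
qed

lemma monomial_Suc:
  "(\<Prod>j\<in>UNIV. (w $ j) ^ Poly_Mapping.lookup (m + Poly_Mapping.single i 1) j)
    = w $ i * (\<Prod>j\<in>UNIV. (w $ j) ^ Poly_Mapping.lookup m j)"
  for w :: "complex^'n"
proof -
  have "(\<Prod>j\<in>UNIV. (w $ j) ^ Poly_Mapping.lookup (m + Poly_Mapping.single i 1) j)
      = (\<Prod>j\<in>UNIV. (w $ j) ^ Poly_Mapping.lookup m j * (if j = i then w $ j else 1))"
    by (rule prod.cong) (auto simp: lookup_add lookup_single when_def)
  then show ?thesis
    by (simp add: prod.distrib mult.commute)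
qed

text \<open>On symbols, applying \<open>\<partial>\<^sub>i\<close> is multiplication by \<open>z\<^sub>i\<close>. The polynomial \<open>R\<close> is \<open>Q\<close> with all exponents of
  the \<open>i\<close>-th variable raised by one.\<close>

lemma partial_diff_operator:
  fixes Q :: "'n::finite cmpoly"
  obtains R :: "'n cmpoly" where "\<And>z. eval_cmpoly R z = z $ i * eval_cmpoly Q z"
    and "\<And>f. smooth f \<Longrightarrow> partial i (diff_operator Q f) = diff_operator R f"
proof
  define R where "R = (\<Sum>m\<in>Poly_Mapping.keys Q. Poly_Mapping.single (m + Poly_Mapping.single i 1) (Poly_Mapping.lookup Q m))"
  show "eval_cmpoly R z = z $ i * eval_cmpoly Q z" for z
    unfolding R_def eval_cmpoly_sum eval_cmpoly_single monomial_Suc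
    by (simp add: eval_cmpoly_def sum_distrib_left mult.left_commute)
  show "partial i (diff_operator Q f) = diff_operator R f" if "smooth f" for f
    unfolding R_def fun_eq_iff diff_operator_sum diff_operator_single mixed_partial_Suc[OF that]
    by (simp add: diff_operator_def[abs_def] partial_linear_combination mixed_partial_smooth that)
qed

lemma diff_operator_smooth: "smooth f \<Longrightarrow> smooth (diff_operator Q f)"
  unfolding diff_operator_def[abs_def]
  by (intro smooth_linear_combination finite_keys mixed_partial_smooth)

text \<open>The polynomial \<open>Q\<close> is the monomial of \<open>m\<close> composed with the transpose of \<open>k\<close>. Each factor
  \<open>\<partial>\<^sub>i\<close> of the derivative contributes, by the chain rule, an operator \<open>\<Sum>j. k\<^sub>j\<^sub>i \<partial>\<^sub>j\<close>, whose symbol is the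
  \<open>i\<close>-th entry of \<open>k\<^sup>T z\<close>.\<close>

lemma mixed_partial_affine:
  fixes k :: "real^'n^'n"
  shows "\<exists>Q::'n cmpoly. (\<forall>z. eval_cmpoly Q z =
        (\<Prod>i\<in>UNIV. ((complex_matrix (transpose k) *v z) $ i) ^ Poly_Mapping.lookup m i)) \<and>
      (\<forall>f y. smooth f \<longrightarrow>
        mixed_partial m (\<lambda>x. f (y + k *v x)) = (\<lambda>x. diff_operator Q f (y + k *v x)))"
proof (induction m rule: exponent_induct)
  case zero
  show ?case
    by (rule exI[of _ "Poly_Mapping.single 0 1"]) (simp add: mixed_partial_0 del: single_one)
next
  case (Suc m i)
  then obtain Q :: "'n cmpoly" where Q: "\<And>z. eval_cmpoly Q z =
        (\<Prod>i\<in>UNIV. ((complex_matrix (transpose k) *v z) $ i) ^ Poly_Mapping.lookup m i)"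
      "\<And>f y. smooth f \<Longrightarrow>
        mixed_partial m (\<lambda>x. f (y + k *v x)) = (\<lambda>x. diff_operator Q f (y + k *v x))"
    by blast
  have "\<exists>R::'n cmpoly. (\<forall>z. eval_cmpoly R z = z $ j * eval_cmpoly Q z) \<and>
      (\<forall>f. smooth f \<longrightarrow> partial j (diff_operator Q f) = diff_operator R f)" for j
    by (rule partial_diff_operator[of j Q]) blast
  then obtain R :: "'n \<Rightarrow> 'n cmpoly" where R: "\<And>j z. eval_cmpoly (R j) z = z $ j * eval_cmpoly Q z"
      "\<And>j f. smooth f \<Longrightarrow> partial j (diff_operator Q f) = diff_operator (R j) f"
    by metis
  define T where "T = (\<Sum>j\<in>UNIV. Poly_Mapping.map ((*) (complex_of_real (k $ j $ i))) (R j))"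
  have "eval_cmpoly T z = (\<Prod>j\<in>UNIV. ((complex_matrix (transpose k) *v z) $ j) ^
      Poly_Mapping.lookup (m + Poly_Mapping.single i 1) j)" for z
    unfolding monomial_Suc T_def Q(1)[symmetric]
    by (simp add: eval_cmpoly_sum eval_cmpoly_scale R(1) sum_distrib_right mult.assoc
        matrix_vector_mult_def complex_matrix_def transpose_def)
  moreover have "mixed_partial (m + Poly_Mapping.single i 1) (\<lambda>x. f (y + k *v x))
      = (\<lambda>x. diff_operator T f (y + k *v x))" if f: "smooth f" for f y
  proof -
    have "mixed_partial (m + Poly_Mapping.single i 1) (\<lambda>x. f (y + k *v x))
        = partial i (\<lambda>x. diff_operator Q f (y + k *v x))"
      unfolding mixed_partial_Suc[OF smooth_compose_affine[OF f]] Q(2)[OF f] ..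
    also have "\<dots> = (\<lambda>x. \<Sum>j\<in>UNIV. complex_of_real (k $ j $ i) * diff_operator (R j) f (y + k *v x))"
      unfolding partial_affine[OF diff_operator_smooth[OF f]] R(2)[OF f] ..
    finally show ?thesis
      by (simp add: T_def diff_operator_sum diff_operator_scale)
  qed
  ultimately show ?case
    by blast
qed

text \<open>Assembling the polynomials of \<open>mixed_partial_affine\<close> gives an operator \<open>T\<close> whose symbol has
  the values of \<open>P \<circ> k\<^sup>T\<close>. Invariance of \<open>P\<close> makes these the values of \<open>P\<close>, so \<open>T = P\<close> as polynomials.\<close>

lemma diff_operator_affine:
  fixes k :: "real^'n^'n"
  assumes P: "\<And>z. eval_cmpoly P (complex_matrix (transpose k) *v z) = eval_cmpoly P z"
    and f: "smooth f"
  shows "diff_operator P (\<lambda>x. f (y + k *v x)) x = diff_operator P f (y + k *v x)"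
proof -
  obtain Q :: "('n \<Rightarrow>\<^sub>0 nat) \<Rightarrow> 'n cmpoly" where "\<forall>m. (\<forall>z. eval_cmpoly (Q m) z =
        (\<Prod>i\<in>UNIV. ((complex_matrix (transpose k) *v z) $ i) ^ Poly_Mapping.lookup m i)) \<and>
      (\<forall>f y. smooth f \<longrightarrow>
        mixed_partial m (\<lambda>x. f (y + k *v x)) = (\<lambda>x. diff_operator (Q m) f (y + k *v x)))"
    using choice[OF allI[OF mixed_partial_affine[where k = k]]] ..
  then have Q: "\<And>m z. eval_cmpoly (Q m) z =
        (\<Prod>i\<in>UNIV. ((complex_matrix (transpose k) *v z) $ i) ^ Poly_Mapping.lookup m i)"
      "\<And>m f y. smooth f \<Longrightarrow>
        mixed_partial m (\<lambda>x. f (y + k *v x)) = (\<lambda>x. diff_operator (Q m) f (y + k *v x))"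
    by simp_all
  define T where "T = (\<Sum>m\<in>Poly_Mapping.keys P. Poly_Mapping.map ((*) (Poly_Mapping.lookup P m)) (Q m))"
  have "eval_cmpoly T z = eval_cmpoly P (complex_matrix (transpose k) *v z)" for z
    by (simp add: T_def eval_cmpoly_sum eval_cmpoly_scale Q(1)) (simp add: eval_cmpoly_def)
  then have "T = P"
    using P by (intro cmpoly_eqI) simp
  moreover have "diff_operator P (\<lambda>x. f (y + k *v x)) x = diff_operator T f (y + k *v x)"
    by (simp add: T_def diff_operator_sum diff_operator_scale) (simp add: diff_operator_def Q(2)[OF f])
  ultimately show ?thesis
    by simp
qed

lemma diff_operator_linear_combination:
  assumes "finite J" and "\<And>j. j \<in> J \<Longrightarrow> smooth (f j)"
  shows "diff_operator P (\<lambda>x. \<Sum>j\<in>J. c j * f j x) x = (\<Sum>j\<in>J. c j * diff_operator P (f j) x)"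
proof -
  have "mixed_partial m (\<lambda>x. \<Sum>j\<in>J. c j * f j x) = (\<lambda>x. \<Sum>j\<in>J. c j * mixed_partial m (f j) x)" for m
  proof (induction m rule: exponent_induct)
    case zero
    then show ?case by (simp add: mixed_partial_0)
  next
    case (Suc m i)
    have "smooth (\<lambda>x. \<Sum>j\<in>J. c j * f j x)"
      using assms by (rule smooth_linear_combination)
    then have "mixed_partial (m + Poly_Mapping.single i 1) (\<lambda>x. \<Sum>j\<in>J. c j * f j x)
        = partial i (\<lambda>x. \<Sum>j\<in>J. c j * mixed_partial m (f j) x)"
      by (simp only: mixed_partial_Suc Suc)
    also have "\<dots> = (\<lambda>x. \<Sum>j\<in>J. c j * partial i (mixed_partial m (f j)) x)"
      using assms by (intro partial_linear_combination mixed_partial_smooth)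
    also have "\<dots> = (\<lambda>x. \<Sum>j\<in>J. c j * mixed_partial (m + Poly_Mapping.single i 1) (f j) x)"
      using assms(2) by (simp only: mixed_partial_Suc cong: sum.cong)
    finally show ?case .
  qed
  then show ?thesis
    by (simp add: diff_operator_def sum_distrib_left mult.left_commute sum.swap[of _ J])
qed

section \<open>Exponentials\<close>

definition exponential :: "complex^'n \<Rightarrow> real^'n \<Rightarrow> complex" where
  "exponential l x = exp (\<Sum>i\<in>UNIV. l $ i * complex_of_real (x $ i))"

lemma exponential_add: "exponential l (x + y) = exponential l x * exponential l y"
  by (simp add: exponential_def exp_add[symmetric] sum.distrib algebra_simps)

lemma continuous_on_exponential: "continuous_on S (exponential l)"
  unfolding exponential_def by (intro continuous_intros)

lemma exponential_has_partial_derivative: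
  "((\<lambda>t. exponential l (x + t *\<^sub>R axis i 1)) has_vector_derivative l $ i * exponential l x) (at 0)"
proof -
  have *: "exponential l (x + t *\<^sub>R axis i 1) = exponential l x * exp (of_real t * l $ i)" for t
  proof -
    have "(\<Sum>j\<in>UNIV. l $ j * complex_of_real ((t *\<^sub>R axis i 1) $ j)) = of_real t * l $ i"
      by (simp add: axis_def if_distrib sum.delta cong: if_cong)
    then show ?thesis
      unfolding exponential_add by (simp add: exponential_def)
  qed
  show ?thesis
    unfolding * by (auto intro!: derivative_eq_intros has_vector_derivative_real_field)
qed

lemma partial_exponential: "partial i (exponential l) = (\<lambda>x. l $ i * exponential l x)"
  by (intro ext partial_eqI exponential_has_partial_derivative)

lemma smooth_exponential: "smooth (exponential l)"
proof (rule smooth_coinduct[where S = "range (\<lambda>a x. a * exponential l x)"])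
  show "exponential l \<in> range (\<lambda>a x. a * exponential l x)"
    by (rule range_eqI[of _ _ 1]) simp
next
  fix g assume "g \<in> range (\<lambda>a x. a * exponential l x)"
  then obtain a where g: "g = (\<lambda>x. a * exponential l x)"
    by blast
  show "continuous_on UNIV g"
    unfolding g by (intro continuous_intros continuous_on_exponential)
  have deriv: "((\<lambda>t. g (x + t *\<^sub>R axis i 1)) has_vector_derivative a * (l $ i * exponential l x)) (at 0)" for i x
    unfolding g by (intro has_vector_derivative_mult_right exponential_has_partial_derivative)
  then show "(\<lambda>t::real. g (x + t *\<^sub>R axis i 1)) differentiable (at 0)" for i x
    by (rule differentiableI_vector)
  have "partial i g = (\<lambda>x. (a * l $ i) * exponential l x)" for i
    using deriv by (intro ext partial_eqI) (simp add: mult.assoc)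
  then show "partial i g \<in> range (\<lambda>a x. a * exponential l x)" for i
    by blast
qed

lemma mixed_partial_exponential:
  "mixed_partial m (exponential l) = (\<lambda>x. (\<Prod>i\<in>UNIV. (l $ i) ^ Poly_Mapping.lookup m i) * exponential l x)"
proof (induction m rule: exponent_induct)
  case zero
  then show ?case by (simp add: mixed_partial_0)
next
  case (Suc m i)
  have "partial i (\<lambda>x. c * exponential l x) = (\<lambda>x. c * (l $ i * exponential l x))" for c
    by (intro ext partial_eqI has_vector_derivative_mult_right exponential_has_partial_derivative)
  then show ?case
    unfolding mixed_partial_Suc[OF smooth_exponential] Suc monomial_Suc
    by (simp add: mult.assoc mult.left_commute)
qed

lemma diff_operator_exponential:
  "diff_operator P (exponential l) x = eval_cmpoly P l * exponential l x"
  by (simp add: diff_operator_def eval_cmpoly_def mixed_partial_exponential sum_distrib_right mult.assoc)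

text \<open>The gradient of an exponential at the origin is its frequency.\<close>

lemma exponential_inj: "inj exponential"
proof (rule injI)
  fix l m :: "complex^'a" assume eq: "exponential l = exponential m"
  have "l $ i = m $ i" for i
  proof -
    have "partial i (exponential l) 0 = partial i (exponential m) 0"
      using eq by simp
    then show ?thesis
      by (simp add: partial_exponential exponential_def)
  qed
  then show "l = m"
    by (simp add: vec_eq_iff)
qed

section \<open>The semidirect product and its two representations\<close>

lemma group_orthogonal_group: "group orthogonal_group"
proof (rule groupI)
  fix A assume "A \<in> carrier (orthogonal_group :: (real^'n^'n) monoid)"
  then show "\<exists>B\<in>carrier orthogonal_group. B \<otimes>\<^bsub>orthogonal_group\<^esub> A = \<one>\<^bsub>orthogonal_group\<^esub>"
    by (intro bexI[of _ "transpose A"])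
      (auto simp: orthogonal_group_def orthogonal_matrix_def)
qed (auto simp: orthogonal_group_def orthogonal_matrix_mul orthogonal_matrix_id matrix_mul_assoc)

lemma complex_matrix_mult_vec: "complex_matrix (A ** B) *v z = complex_matrix A *v (complex_matrix B *v z)"
proof -
  have "complex_matrix (A ** B) = complex_matrix A ** complex_matrix B"
    by (simp add: complex_matrix_def matrix_matrix_mult_def vec_eq_iff)
  then show ?thesis
    by (simp add: matrix_vector_mul_assoc)
qed

lemma complex_matrix_one: "complex_matrix (mat 1) = mat 1"
  by (simp add: complex_matrix_def mat_def vec_eq_iff)

lemma exponential_transpose:
  fixes k :: "real^'n^'n"
  shows "exponential l (transpose k *v x) = exponential (complex_matrix k *v l) x"
proof -
  have "(\<Sum>i\<in>UNIV. l $ i * complex_of_real ((transpose k *v x) $ i))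
      = (\<Sum>i\<in>UNIV. \<Sum>j\<in>UNIV. l $ i * (complex_of_real (k $ j $ i) * complex_of_real (x $ j)))"
    by (simp add: matrix_vector_mult_def transpose_def sum_distrib_left)
  also have "\<dots> = (\<Sum>j\<in>UNIV. \<Sum>i\<in>UNIV. l $ i * (complex_of_real (k $ j $ i) * complex_of_real (x $ j)))"
    by (rule sum.swap)
  also have "\<dots> = (\<Sum>j\<in>UNIV. (complex_matrix k *v l) $ j * complex_of_real (x $ j))"
    by (simp add: matrix_vector_mult_def complex_matrix_def sum_distrib_left sum_distrib_right mult_ac)
  finally show ?thesis
    by (simp add: exponential_def)
qed

context
  fixes K :: "(real^'n^'n) set"
  assumes K: "subgroup K orthogonal_group"
begin

lemma one_in_K: "mat 1 \<in> K"
  using subgroup.one_closed[OF K] by (simp add: orthogonal_group_def)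

lemma mult_in_K: "k \<in> K \<Longrightarrow> h \<in> K \<Longrightarrow> k ** h \<in> K"
  using subgroup.m_closed[OF K] by (simp add: orthogonal_group_def)

lemma transpose_mult_K:
  assumes "k \<in> K"
  shows "transpose k ** k = mat 1" and "k ** transpose k = mat 1"
  using subgroup.subset[OF K] assms by (auto simp: orthogonal_group_def orthogonal_matrix_def)

lemma transpose_in_K:
  assumes "k \<in> K"
  shows "transpose k \<in> K"
proof -
  have "k \<in> carrier orthogonal_group"
    using subgroup.subset[OF K] assms by blast
  moreover from this have "transpose k \<in> carrier orthogonal_group"
    by (simp add: orthogonal_group_def)
  ultimately have "inv\<^bsub>orthogonal_group\<^esub> k = transpose k"
    using transpose_mult_K[OF assms]
    by (intro group.inv_equality[OF group_orthogonal_group]) (auto simp: orthogonal_group_def)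
  then show ?thesis
    using subgroup.m_inv_closed[OF K assms] by simp
qed

lemma semidirect_simps:
  "carrier (semidirect K) = UNIV \<times> K"
  "(x, k) \<otimes>\<^bsub>semidirect K\<^esub> (y, h) = (x + k *v y, k ** h)"
  "\<one>\<^bsub>semidirect K\<^esub> = (0, mat 1)"
  by (simp_all add: semidirect_def)

lemma group_semidirect: "group (semidirect K)"
proof (rule groupI)
  fix g assume "g \<in> carrier (semidirect K)"
  then obtain x k where g: "g = (x, k)" "k \<in> K"
    by (auto simp: semidirect_simps)
  show "\<exists>h\<in>carrier (semidirect K). h \<otimes>\<^bsub>semidirect K\<^esub> g = \<one>\<^bsub>semidirect K\<^esub>"
    using g by (intro bexI[of _ "(- (transpose k *v x), transpose k)"])
      (auto simp: semidirect_simps transpose_mult_K transpose_in_K)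
qed (auto simp: semidirect_simps mult_in_K one_in_K matrix_mul_assoc matrix_vector_mul_assoc
    matrix_vector_right_distrib add.assoc)

lemma affine_act_mult:
  "affine_act (g \<otimes>\<^bsub>semidirect K\<^esub> h) x = affine_act g (affine_act h x)"
  by (cases g; cases h) (simp add: affine_act_def semidirect_simps matrix_vector_right_distrib
      matrix_vector_mul_assoc add.assoc)

text \<open>The invariance of \<open>P\<close> is applied to the transpose of \<open>k\<close>, which is the inverse of \<open>k\<close> and so
  lies in \<open>K\<close>.\<close>

lemma joint_eigenspace_affine_act:
  assumes f: "f \<in> joint_eigenspace K l" and h: "h \<in> carrier (semidirect K)"
  shows "(\<lambda>x. f (affine_act h x)) \<in> joint_eigenspace K l"
proof -
  obtain y k where hk: "h = (y, k)" "k \<in> K"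
    using h by (auto simp: semidirect_simps)
  have smooth: "smooth f"
    using f by (simp add: joint_eigenspace_def)
  have "diff_operator P (\<lambda>x. f (y + k *v x)) x = eval_cmpoly P l * f (y + k *v x)"
    if P: "P \<in> invariant_polynomials K" for P x
  proof -
    have "diff_operator P (\<lambda>x. f (y + k *v x)) x = diff_operator P f (y + k *v x)"
      using P transpose_in_K[OF hk(2)]
      by (intro diff_operator_affine smooth) (auto simp: invariant_polynomials_def)
    then show ?thesis
      using f P by (simp add: joint_eigenspace_def)
  qed
  then show ?thesis
    using smooth_compose_affine[OF smooth] by (simp add: joint_eigenspace_def affine_act_def hk(1))
qed

lemma joint_eigenspace_linear_combination:
  assumes "finite J" and f: "\<And>j. j \<in> J \<Longrightarrow> f j \<in> joint_eigenspace K l"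
  shows "(\<lambda>x. \<Sum>j\<in>J. c j * f j x) \<in> joint_eigenspace K l"
proof -
  have "\<And>j. j \<in> J \<Longrightarrow> smooth (f j)"
    using f by (simp add: joint_eigenspace_def)
  with f show ?thesis
    by (simp add: joint_eigenspace_def diff_operator_linear_combination[OF \<open>finite J\<close>]
        smooth_linear_combination[OF \<open>finite J\<close>] sum_distrib_left mult.left_commute)
qed

lemma complex_subspace_joint_eigenspace: "complex_subspace (joint_eigenspace K l)"
  unfolding complex_subspace_def
proof (intro conjI ballI allI)
  show "(\<lambda>x. 0) \<in> joint_eigenspace K l"
    using joint_eigenspace_linear_combination[where J = "{} :: unit set"] by simp
next
  fix f h assume "f \<in> joint_eigenspace K l" "h \<in> joint_eigenspace K l"
  then show "(\<lambda>x. f x + h x) \<in> joint_eigenspace K l"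
    using joint_eigenspace_linear_combination[where J = "UNIV :: bool set" and f = "\<lambda>b. if b then f else h" and c = "\<lambda>_. 1"]
    by (simp add: UNIV_bool add.commute)
next
  fix a f assume "f \<in> joint_eigenspace K l"
  then show "(\<lambda>x. a * f x) \<in> joint_eigenspace K l"
    using joint_eigenspace_linear_combination[where J = "{()}" and f = "\<lambda>_. f" and c = "\<lambda>_. a"]
    by simp
qed

lemma representation_eigenspace:
  "representation (semidirect K) (eigenspace_action K) (joint_eigenspace K l)"
proof -
  interpret G: group "semidirect K" by (rule group_semidirect)
  show ?thesis
    unfolding representation_def
  proof (intro conjI ballI group_semidirect complex_subspace_joint_eigenspace)
    show "complex_linear_on (joint_eigenspace K l) (eigenspace_action K g)" for g
      by (simp add: complex_linear_on_def eigenspace_action_def)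
    show "eigenspace_action K g f \<in> joint_eigenspace K l"
      if "g \<in> carrier (semidirect K)" "f \<in> joint_eigenspace K l" for g f
      unfolding eigenspace_action_def using that by (intro joint_eigenspace_affine_act) auto
    show "eigenspace_action K \<one>\<^bsub>semidirect K\<^esub> f = f" for f
      by (simp add: eigenspace_action_def) (simp add: affine_act_def semidirect_simps)
    show "eigenspace_action K (g \<otimes>\<^bsub>semidirect K\<^esub> h) f = eigenspace_action K g (eigenspace_action K h f)"
      if "g \<in> carrier (semidirect K)" "h \<in> carrier (semidirect K)" for g h f
      using that by (simp add: eigenspace_action_def G.inv_mult_group affine_act_mult)
  qed
qed

lemma representation_induced:
  "representation (semidirect K) (induced_action K) (induced_space K c)"
proof -
  interpret G: group "semidirect K" by (rule group_semidirect)
  have [simp]: "(x, mat 1) \<in> carrier (semidirect K)" for x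
    by (simp add: semidirect_simps one_in_K)
  show ?thesis
    unfolding representation_def
  proof (intro conjI ballI group_semidirect)
    show "complex_subspace (induced_space K c)"
      by (simp add: complex_subspace_def induced_space_def algebra_simps)
    show "complex_linear_on (induced_space K c) (induced_action K g)" for g
      by (auto simp: complex_linear_on_def induced_action_def)
    show "induced_action K g f \<in> induced_space K c"
      if g: "g \<in> carrier (semidirect K)" and f: "f \<in> induced_space K c" for g f
      using g f by (auto simp: induced_action_def induced_space_def G.m_assoc[symmetric])
    show "induced_action K \<one>\<^bsub>semidirect K\<^esub> f = f" if "f \<in> induced_space K c" for f
      using that by (auto simp: induced_action_def induced_space_def)
    show "induced_action K (g \<otimes>\<^bsub>semidirect K\<^esub> h) f = induced_action K g (induced_action K h f)"
      if "g \<in> carrier (semidirect K)" "h \<in> carrier (semidirect K)" for g h f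
      using that by (auto simp: induced_action_def G.inv_mult_group G.m_assoc)
  qed
qed

lemma exponential_in_joint_eigenspace:
  assumes "k \<in> K"
  shows "exponential (complex_matrix k *v l) \<in> joint_eigenspace K l"
  using assms by (simp add: joint_eigenspace_def smooth_exponential diff_operator_exponential invariant_polynomials_def)

text \<open>If \<open>k l = h l\<close> then \<open>k\<^sup>T h\<close> fixes \<open>l\<close>, and only the identity does.\<close>

lemma generic_orbit_inj:
  assumes "generic_vector K l"
  shows "inj_on (\<lambda>k. complex_matrix k *v l) K"
proof (rule inj_onI)
  fix k h assume kh: "k \<in> K" "h \<in> K" and eq: "complex_matrix k *v l = complex_matrix h *v l"
  have "complex_matrix (transpose k ** h) *v l = complex_matrix (transpose k ** k) *v l"
    by (simp only: complex_matrix_mult_vec eq)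
  then have "complex_matrix (transpose k ** h) *v l = l"
    by (simp add: transpose_mult_K kh complex_matrix_one)
  then have "transpose k ** h = mat 1"
    using assms kh by (auto simp: generic_vector_def mult_in_K transpose_in_K)
  then have "k ** (transpose k ** h) = k"
    by simp
  then show "k = h"
    using kh by (simp add: matrix_mul_assoc transpose_mult_K)
qed

text \<open>This is covariance applied to the factorization \<open>(x, k) = (0, k) (k\<^sup>T x, 1)\<close>. It shows that an
  element of the induced space amounts to a function on \<open>K\<close>.\<close>

lemma induced_space_exponential:
  assumes f: "f \<in> induced_space K (exponential (- l))" and k: "k \<in> K"
  shows "f (x, k) = f (0, k) * exponential (complex_matrix k *v l) x"
proof -
  have "k *v (transpose k *v x) = x"
    by (simp only: matrix_vector_mul_assoc transpose_mult_K[OF k] matrix_vector_mul_lid)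
  then have "(x, k) = (0, k) \<otimes>\<^bsub>semidirect K\<^esub> (transpose k *v x, mat 1)"
    unfolding semidirect_simps by (simp only: matrix_mul_rid add_0)
  moreover have "f ((0, k) \<otimes>\<^bsub>semidirect K\<^esub> (transpose k *v x, mat 1))
      = inverse (exponential (- l) (transpose k *v x)) * f (0, k)"
    using f k by (simp add: induced_space_def semidirect_simps(1))
  moreover have "inverse (exponential (- l) y) = exponential l y" for y
    by (simp add: exponential_def sum_negf exp_minus)
  ultimately have "f (x, k) = exponential l (transpose k *v x) * f (0, k)"
    by simp
  then show ?thesis
    by (simp only: exponential_transpose mult.commute)
qed

end

section \<open>Embedding the induced representation\<close>

definition fibre_sum :: "(real^'n^'n) set \<Rightarrow> ((real^'n) \<times> (real^'n^'n) \<Rightarrow> complex) \<Rightarrow> real^'n \<Rightarrow> complex" where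
  "fibre_sum K f x = (\<Sum>k\<in>K. f (x, k))"

text \<open>The inverse of \<open>g\<close>, of rotation part \<open>h\<close>, moves the fibre over \<open>x\<close> to another fibre while
  permuting \<open>K\<close> by \<open>k \<mapsto> h k\<close>; the sum over \<open>K\<close> does not see the permutation.\<close>

lemma fibre_sum_equivariant:
  fixes K :: "(real^'n^'n) set"
  assumes K: "subgroup K orthogonal_group" and g: "g \<in> carrier (semidirect K)"
  shows "fibre_sum K (induced_action K g f) = eigenspace_action K g (fibre_sum K f)"
proof
  fix x
  interpret G: group "semidirect K" by (rule group_semidirect[OF K])
  obtain y h where yh: "inv\<^bsub>semidirect K\<^esub> g = (y, h)" and h: "h \<in> K"
    using G.inv_closed[OF g] by (auto simp: semidirect_simps[OF K])
  have "fibre_sum K (induced_action K g f) x = (\<Sum>k\<in>K. f (y + h *v x, h ** k))"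
    by (simp add: fibre_sum_def induced_action_def yh semidirect_simps[OF K])
  also have "\<dots> = (\<Sum>k\<in>K. f (y + h *v x, k))"
    by (rule sum.reindex_bij_witness[where i = "\<lambda>k. transpose h ** k" and j = "\<lambda>k. h ** k"])
      (auto simp: matrix_mul_assoc transpose_mult_K[OF K h] mult_in_K[OF K] transpose_in_K[OF K] h)
  also have "\<dots> = eigenspace_action K g (fibre_sum K f) x"
    by (simp add: fibre_sum_def eigenspace_action_def yh affine_act_def)
  finally show "fibre_sum K (induced_action K g f) x = eigenspace_action K g (fibre_sum K f) x" .
qed

text \<open>Both fibre sums are combinations of the exponentials of the frequencies \<open>k l\<close>, which genericity
  keeps apart; independence lets the coefficients be compared.\<close>

lemma fibre_sum_inj:
  fixes K :: "(real^'n^'n) set"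
  assumes K: "subgroup K orthogonal_group" and "finite K" and generic: "generic_vector K l"
  shows "inj_on (fibre_sum K) (induced_space K (exponential (- l)))"
proof (rule inj_onI)
  fix f h assume f: "f \<in> induced_space K (exponential (- l))" and h: "h \<in> induced_space K (exponential (- l))"
    and eq: "fibre_sum K f = fibre_sum K h"
  have "f (0, k) - h (0, k) = 0" if k: "k \<in> K" for k
  proof (rule dedekind_independence[where S = K and \<phi> = "\<lambda>k. exponential (complex_matrix k *v l)"
        and op = "(+)" and c = "\<lambda>k. f (0, k) - h (0, k)", OF \<open>finite K\<close> _ _ _ _ k])
    show "inj_on (\<lambda>k. exponential (complex_matrix k *v l)) K"
      using comp_inj_on[OF generic_orbit_inj[OF K generic] inj_on_subset[OF exponential_inj subset_UNIV]]
      by (simp add: o_def)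
    show "\<exists>x. exponential m x \<noteq> 0" for m :: "complex^'n"
      by (simp add: exponential_def)
    show "(\<Sum>k\<in>K. (f (0, k) - h (0, k)) * exponential (complex_matrix k *v l) x) = 0" for x
    proof -
      have "(\<Sum>k\<in>K. (f (0, k) - h (0, k)) * exponential (complex_matrix k *v l) x)
          = fibre_sum K f x - fibre_sum K h x"
        unfolding fibre_sum_def sum_subtractf[symmetric]
        by (rule sum.cong) (auto simp: induced_space_exponential[OF K f, where x = x]
            induced_space_exponential[OF K h, where x = x] left_diff_distrib)
      then show ?thesis
        by (simp add: eq)
    qed
  qed (rule exponential_add)
  then have on_K: "f (x, k) = h (x, k)" if "k \<in> K" for x k
    using that by (simp add: induced_space_exponential[OF K f, where x = x] induced_space_exponential[OF K h, where x = x])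
  show "f = h"
  proof
    fix g :: "(real^'n) \<times> (real^'n^'n)"
    obtain x k where "g = (x, k)"
      by (cases g)
    then show "f g = h g"
      using f h on_K by (cases "k \<in> K") (auto simp: induced_space_def semidirect_simps(1)[OF K])
  qed
qed

lemma fibre_sum_in_joint_eigenspace:
  fixes K :: "(real^'n^'n) set"
  assumes K: "subgroup K orthogonal_group" and "finite K" and f: "f \<in> induced_space K (exponential (- l))"
  shows "fibre_sum K f \<in> joint_eigenspace K l"
proof -
  have "fibre_sum K f = (\<lambda>x. \<Sum>k\<in>K. f (0, k) * exponential (complex_matrix k *v l) x)"
    by (intro ext, unfold fibre_sum_def, intro sum.cong refl induced_space_exponential[OF K f])
  then show ?thesis
    using \<open>finite K\<close> by (simp add: joint_eigenspace_linear_combination[OF K] exponential_in_joint_eigenspace[OF K])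
qed

lemma unitary_character_exponential:
  assumes "imaginary_vector l"
  shows "unitary_character (exponential (- l))"
  using assms
  by (simp add: unitary_character_def exponential_add continuous_on_exponential)
    (simp add: exponential_def imaginary_vector_def)

theorem theorem3p11:
  fixes K :: "(real^'n^'n) set" and l :: "complex^'n"
  assumes "finite_pseudo_reflection_group K"
    and "imaginary_vector l" and "generic_vector K l"
  shows "\<exists>c. unitary_character c \<and> generic_character K c \<and>
    (\<exists>A. rep_monomorphism (semidirect K)
           (induced_action K) (induced_space K c)
           (eigenspace_action K) (joint_eigenspace K l) A)"
proof (intro exI conjI)
  have K: "subgroup K orthogonal_group" and "finite K"
    using assms(1) by (auto simp: finite_pseudo_reflection_group_def)
  show "unitary_character (exponential (- l))"
    using assms(2) by (rule unitary_character_exponential)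
  show "generic_character K (exponential (- l))"
    unfolding generic_character_def
    using assms(2,3) by (intro exI[of _ l]) (simp add: exponential_def sum_negf)
  have "complex_linear_on (induced_space K (exponential (- l))) (fibre_sum K)"
    by (simp add: complex_linear_on_def fibre_sum_def[abs_def] sum.distrib sum_distrib_left)
  then show "rep_monomorphism (semidirect K) (induced_action K) (induced_space K (exponential (- l)))
      (eigenspace_action K) (joint_eigenspace K l) (fibre_sum K)"
    unfolding rep_monomorphism_def
    using representation_induced[OF K] representation_eigenspace[OF K]
      fibre_sum_in_joint_eigenspace[OF K \<open>finite K\<close>] fibre_sum_inj[OF K \<open>finite K\<close> assms(3)]
      fibre_sum_equivariant[OF K]
    by blast
qed

end
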